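(* Let $A$ be an $n\times n$ permutation matrix and let $X$ be a proper doubly stochastic solution of $AXA=XAX$, i.e. $X$ is a doubly stochastic $n\times n$ matrix which is not a permutation matrix and satisfies $AXA=XAX$. Then there exists an inner inverse $Y$ of $X$ (a matrix with $XYX=X$) which is also a doubly stochastic matrix.
   Context: A doubly stochastic matrix is a real square matrix with nonnegative entries, all of whose row sums and column sums equal $1$. *)

theory Defs
  imports "HOL-Analysis.Analysis"
begin

definition permutation_matrix :: "real ^ 'n ^ 'n \<Rightarrow> bool" where
  "permutation_matrix A \<longleftrightarrow>
     (\<exists>p. p permutes UNIV \<and> A = (\<chi> i j. if j = p i then 1 else 0))"

definition doubly_stochastic :: "real ^ 'n ^ 'n \<Rightarrow> bool" where
  "doubly_stochastic X \<longleftrightarrow>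
     (\<forall>i j. 0 \<le> X $ i $ j) \<and>
     (\<forall>i. (\<Sum>j\<in>UNIV. X $ i $ j) = 1) \<and>
     (\<forall>j. (\<Sum>i\<in>UNIV. X $ i $ j) = 1)"

definition proper_doubly_stochastic :: "real ^ 'n ^ 'n \<Rightarrow> bool" where
  "proper_doubly_stochastic X \<longleftrightarrow> doubly_stochastic X \<and> \<not> permutation_matrix X"

definition inner_inverse :: "real ^ 'n ^ 'm \<Rightarrow> real ^ 'm ^ 'n \<Rightarrow> bool" where
  "inner_inverse X Y \<longleftrightarrow> X ** Y ** X = X"

end

theory Submission
  imports Defs
begin

text \<open>
  The transpose of \<open>X\<close> is the required inner inverse. Only two facts about the matrices enter:
  \<open>A\<close> is orthogonal, and \<open>X\<close> is a contraction for the Euclidean norm, because its rows are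
  convex weights (Jensen) and its columns sum to one.

  Put \<open>U = A X\<close>, again a contraction. The equation \<open>A X A = X A X\<close> says \<open>U\<^sup>2 = A U A\<close>, so
  \<open>U\<^sup>2\<close> and \<open>U\<close> have the same Frobenius norm. Row by row, multiplication by the contraction \<open>U\<close>
  can only shorten the rows of \<open>U\<close>; as the total length is kept, no row is shortened.
  A vector whose length is kept by a contraction \<open>M\<close> is fixed by \<open>M\<^sup>T M\<close>, whence
  \<open>U U U\<^sup>T = U\<close>. The hypotheses are stable under transposition, so \<open>U\<^sup>T U U = U\<close> as well. These two
  identities force \<open>U\<close> and \<open>U\<^sup>T\<close> to have the same range, on which \<open>U U\<^sup>T\<close> is the identity,
  so that \<open>U U\<^sup>T U = U\<close>; cancelling \<open>A\<close> gives \<open>X X\<^sup>T X = X\<close>.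
\<close>

section \<open>Frobenius norm and orthogonal factors\<close>

lemma norm_matrix_power2_rows:
  fixes M :: "real ^ 'n ^ 'm"
  shows "(norm M)\<^sup>2 = (\<Sum>i\<in>UNIV. (norm (M $ i))\<^sup>2)"
  by (simp add: norm_vec_def L2_set_def sum_nonneg)

lemma norm_transpose_matrix:
  fixes M :: "real ^ 'n ^ 'm"
  shows "norm (transpose M) = norm M"
proof -
  have "(norm (transpose M))\<^sup>2 = (norm M)\<^sup>2"
    unfolding power2_norm_eq_inner inner_vec_def transpose_def
    by (simp add: sum.swap[of _ "UNIV :: 'n set"])
  then show ?thesis by simp
qed

lemma row_matrix_mult:
  fixes M :: "real ^ 'n ^ 'm" and N :: "real ^ 'k ^ 'n"
  shows "(M ** N) $ i = transpose N *v (M $ i)"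
  by (simp add: vec_eq_iff matrix_matrix_mult_def matrix_vector_mult_def transpose_def mult.commute)

lemma norm_orthogonal_matrix_vector_mult:
  fixes Q :: "real ^ 'n ^ 'n"
  assumes "orthogonal_matrix Q"
  shows "norm (Q *v x) = norm x"
  using assms by (metis matrix_of_matrix_vector_mul matrix_vector_mul_linear
      orthogonal_transformation orthogonal_transformation_matrix)

lemma norm_matrix_mult_orthogonal_right:
  fixes M :: "real ^ 'n ^ 'm" and Q :: "real ^ 'n ^ 'n"
  assumes "orthogonal_matrix Q"
  shows "norm (M ** Q) = norm M"
proof -
  have "(norm (M ** Q))\<^sup>2 = (norm M)\<^sup>2"
    using assms
    by (simp add: norm_matrix_power2_rows row_matrix_mult norm_orthogonal_matrix_vector_mult
        del: transpose_matrix_vector)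
  then show ?thesis by simp
qed

lemma norm_matrix_mult_orthogonal_left:
  fixes M :: "real ^ 'm ^ 'n" and Q :: "real ^ 'n ^ 'n"
  assumes "orthogonal_matrix Q"
  shows "norm (Q ** M) = norm M"
  using norm_matrix_mult_orthogonal_right[of "transpose Q" "transpose M"] assms
  by (metis matrix_transpose_mul norm_transpose_matrix orthogonal_matrix_transpose)

section \<open>Contractions\<close>

lemma contraction_transpose:
  fixes M :: "real ^ 'n ^ 'm"
  assumes "\<And>x. norm (M *v x) \<le> norm x"
  shows "norm (transpose M *v y) \<le> norm y"
proof -
  let ?z = "transpose M *v y"
  have "norm ?z * norm ?z = y \<bullet> (M *v ?z)"
    by (metis dot_lmul_matrix norm_eq_square power2_eq_square power2_norm_eq_inner
        transpose_matrix_vector)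
  also have "\<dots> \<le> norm y * norm (M *v ?z)" by (rule norm_cauchy_schwarz)
  also have "\<dots> \<le> norm y * norm ?z" using assms by (simp add: mult_left_mono)
  finally show ?thesis
    by (cases "norm ?z = 0") (auto simp: mult_le_cancel_right)
qed

text \<open>
  Equality case of the contraction property: expanding the square,
  \<open>\<parallel>M\<^sup>T M x - x\<parallel>\<^sup>2 = \<parallel>M\<^sup>T M x\<parallel>\<^sup>2 - 2 \<parallel>M x\<parallel>\<^sup>2 + \<parallel>x\<parallel>\<^sup>2\<close>, which is at most \<open>0\<close> once
  \<open>\<parallel>M x\<parallel> = \<parallel>x\<parallel>\<close>.
\<close>

lemma contraction_norm_eq_imp_fixed:
  fixes M :: "real ^ 'n ^ 'm"
  assumes contr: "\<And>x. norm (M *v x) \<le> norm x"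
    and eq: "norm (M *v x) = norm x"
  shows "transpose M *v (M *v x) = x"
proof -
  let ?z = "transpose M *v (M *v x)"
  have "?z \<bullet> x = (norm (M *v x))\<^sup>2"
    by (simp add: dot_lmul_matrix power2_norm_eq_inner)
  then have "(norm (?z - x))\<^sup>2 = (norm ?z)\<^sup>2 - 2 * (norm (M *v x))\<^sup>2 + (norm x)\<^sup>2"
    by (simp add: power2_norm_eq_inner inner_diff inner_commute)
  moreover have "(norm ?z)\<^sup>2 \<le> (norm (M *v x))\<^sup>2"
    using contraction_transpose[OF contr] by (intro power_mono) auto
  ultimately have "(norm (?z - x))\<^sup>2 \<le> 0" using eq by simp
  then show ?thesis by simp
qed

text \<open>
  The rows of \<open>N M\<close> are the images of the rows of \<open>N\<close> under the contraction \<open>M\<^sup>T\<close>. If the sum of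
  their squared lengths does not drop, then no single one does.
\<close>

lemma contraction_norm_mult_eq_imp:
  fixes N :: "real ^ 'n ^ 'm" and M :: "real ^ 'k ^ 'n"
  assumes contr: "\<And>x. norm (M *v x) \<le> norm x"
    and eq: "norm (N ** M) = norm N"
  shows "N ** M ** transpose M = N"
proof -
  have contr': "norm (transpose M *v y) \<le> norm y" for y
    using contraction_transpose[OF contr] .
  have sums: "(\<Sum>i\<in>UNIV. (norm (N $ i))\<^sup>2 - (norm (transpose M *v (N $ i)))\<^sup>2) = 0"
    using arg_cong[OF eq, of "\<lambda>t. t\<^sup>2"]
    by (simp add: norm_matrix_power2_rows row_matrix_mult sum_subtractf)
  have "(norm (N $ i))\<^sup>2 - (norm (transpose M *v (N $ i)))\<^sup>2 = 0" for i
  proof -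
    have "\<forall>i\<in>UNIV. (norm (N $ i))\<^sup>2 - (norm (transpose M *v (N $ i)))\<^sup>2 = 0"
      using sums by (subst (asm) sum_nonneg_eq_0_iff) (auto intro: power_mono contr'
          simp del: transpose_matrix_vector)
    then show ?thesis by blast
  qed
  then have row_eq: "norm (transpose M *v (N $ i)) = norm (N $ i)" for i
    by (metis eq_iff_diff_eq_0 norm_ge_zero power2_eq_iff_nonneg)
  have "(N ** M ** transpose M) $ i = N $ i" for i
    using contraction_norm_eq_imp_fixed[of "transpose M", OF contr' row_eq[of i]]
    by (simp only: row_matrix_mult transpose_transpose)
  then show ?thesis by (simp add: vec_eq_iff)
qed

section \<open>Contractions braided with an orthogonal matrix\<close>

lemma contraction_square_orthogonal_equiv_imp:
  fixes U Q :: "real ^ 'n ^ 'n"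
  assumes "orthogonal_matrix Q"
    and "\<And>x. norm (U *v x) \<le> norm x"
    and "U ** U = Q ** U ** Q"
  shows "U ** U ** transpose U = U"
  using assms
  by (intro contraction_norm_mult_eq_imp)
    (simp_all add: norm_matrix_mult_orthogonal_left norm_matrix_mult_orthogonal_right)

text \<open>
  Both \<open>U U U\<^sup>T = U\<close> and \<open>U\<^sup>T U U = U\<close> are available, the second by passing to transposes.
  They are combined to \<open>U\<^sup>T U U\<^sup>T = U\<^sup>T\<close>, whose transpose is the claim.
\<close>

lemma contraction_square_orthogonal_equiv_imp_partial_isometry:
  fixes U Q :: "real ^ 'n ^ 'n"
  assumes orth: "orthogonal_matrix Q"
    and contr: "\<And>x. norm (U *v x) \<le> norm x"
    and sq: "U ** U = Q ** U ** Q"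
  shows "U ** transpose U ** U = U"
proof -
  let ?T = "transpose U"
  have right: "U ** U ** ?T = U"
    using contraction_square_orthogonal_equiv_imp[OF orth contr sq] .
  have sq': "?T ** ?T = transpose Q ** ?T ** transpose Q"
    using arg_cong[OF sq, of transpose] by (simp add: matrix_transpose_mul matrix_mul_assoc)
  have right': "?T ** ?T ** U = ?T"
    using contraction_square_orthogonal_equiv_imp[of "transpose Q" ?T]
      orth contraction_transpose[OF contr] sq'
    by (simp add: orthogonal_matrix_transpose)
  have left: "?T ** U ** U = U" and left': "U ** ?T ** ?T = ?T"
    using arg_cong[OF right', of transpose] arg_cong[OF right, of transpose]
    by (simp_all add: matrix_transpose_mul matrix_mul_assoc)
  have "?T ** U ** ?T = ?T ** U ** (U ** ?T ** ?T)" by (simp only: left')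
  also have "\<dots> = (?T ** U ** U) ** ?T ** ?T" by (simp only: matrix_mul_assoc)
  also have "\<dots> = ?T" by (simp only: left left')
  finally show ?thesis
    by (metis matrix_mul_assoc matrix_transpose_mul transpose_transpose)
qed

lemma contraction_braid_orthogonal_imp_partial_isometry:
  fixes X Q :: "real ^ 'n ^ 'n"
  assumes orth: "orthogonal_matrix Q"
    and contr: "\<And>x. norm (X *v x) \<le> norm x"
    and braid: "Q ** X ** Q = X ** Q ** X"
  shows "X ** transpose X ** X = X"
proof -
  have inv: "transpose Q ** Q = mat 1" using orth by (simp add: orthogonal_matrix_def)
  let ?U = "Q ** X"
  have "norm (?U *v x) \<le> norm x" for x
    using contr[of x] norm_orthogonal_matrix_vector_mult[OF orth, of "X *v x"]
    by (simp add: matrix_vector_mul_assoc)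
  moreover have "?U ** ?U = Q ** ?U ** Q"
    using braid by (metis matrix_mul_assoc)
  ultimately have "?U ** transpose ?U ** ?U = ?U"
    by (rule contraction_square_orthogonal_equiv_imp_partial_isometry[OF orth])
  then have "Q ** (X ** transpose X ** X) = Q ** X"
    using inv by (metis matrix_mul_assoc matrix_mul_lid matrix_transpose_mul)
  then show ?thesis
    using inv by (metis matrix_mul_assoc matrix_mul_lid)
qed

section \<open>Permutation matrices and doubly stochastic matrices\<close>

lemma permutation_matrix_imp_orthogonal_matrix:
  fixes A :: "real ^ 'n ^ 'n"
  assumes "permutation_matrix A"
  shows "orthogonal_matrix A"
proof -
  obtain p where p: "p permutes UNIV" and A: "A = (\<chi> i j. if j = p i then 1 else 0)"
    using assms by (auto simp: permutation_matrix_def)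
  have "A ** transpose A = mat 1"
    using permutes_inj[OF p]
    by (auto simp: A vec_eq_iff matrix_matrix_mult_def transpose_def mat_def inj_eq
        if_distrib[of "\<lambda>t. t * _"] cong: if_cong)
  then show ?thesis
    by (simp add: orthogonal_matrix_def matrix_left_right_inverse)
qed

lemma doubly_stochastic_transpose:
  "doubly_stochastic X \<Longrightarrow> doubly_stochastic (transpose X)"
  by (simp add: doubly_stochastic_def transpose_def)

text \<open>
  Jensen's inequality for the square, with the weights in a row of \<open>X\<close>: the weighted mean of
  the squares exceeds the square of the mean by the variance. Summing over the rows and using that
  the columns sum to one gives the bound.
\<close>

lemma doubly_stochastic_contraction:
  fixes X :: "real ^ 'n ^ 'n"
  assumes "doubly_stochastic X"
  shows "norm (X *v x) \<le> norm x"
proof -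
  have nonneg: "0 \<le> X $ i $ j" and row: "(\<Sum>j\<in>UNIV. X $ i $ j) = 1"
    and col: "(\<Sum>i\<in>UNIV. X $ i $ j) = 1" for i j
    using assms by (auto simp: doubly_stochastic_def)
  have jensen: "((X *v x) $ i)\<^sup>2 \<le> (\<Sum>j\<in>UNIV. X $ i $ j * (x $ j)\<^sup>2)" for i
  proof -
    define m where "m = (X *v x) $ i"
    have m: "(\<Sum>j\<in>UNIV. X $ i $ j * x $ j) = m"
      by (simp add: m_def matrix_vector_mult_def)
    have "0 \<le> (\<Sum>j\<in>UNIV. X $ i $ j * (x $ j - m)\<^sup>2)"
      by (intro sum_nonneg mult_nonneg_nonneg nonneg) simp
    also have "\<dots> = (\<Sum>j\<in>UNIV. X $ i $ j * (x $ j)\<^sup>2 - 2 * m * (X $ i $ j * x $ j) + m\<^sup>2 * X $ i $ j)"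
      by (intro sum.cong) (auto simp: power2_eq_square algebra_simps)
    also have "\<dots> = (\<Sum>j\<in>UNIV. X $ i $ j * (x $ j)\<^sup>2)
        - 2 * m * (\<Sum>j\<in>UNIV. X $ i $ j * x $ j) + m\<^sup>2 * (\<Sum>j\<in>UNIV. X $ i $ j)"
      by (simp only: sum.distrib sum_subtractf sum_distrib_left)
    also have "\<dots> = (\<Sum>j\<in>UNIV. X $ i $ j * (x $ j)\<^sup>2) - m\<^sup>2"
      by (simp add: m row power2_eq_square)
    finally show ?thesis by (simp add: m_def)
  qed
  have "(norm (X *v x))\<^sup>2 = (\<Sum>i\<in>UNIV. ((X *v x) $ i)\<^sup>2)"
    by (simp add: norm_vec_def L2_set_def sum_nonneg)
  also have "\<dots> \<le> (\<Sum>i\<in>UNIV. \<Sum>j\<in>UNIV. X $ i $ j * (x $ j)\<^sup>2)"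
    by (intro sum_mono jensen)
  also have "\<dots> = (\<Sum>j\<in>UNIV. (\<Sum>i\<in>UNIV. X $ i $ j) * (x $ j)\<^sup>2)"
    by (subst sum.swap) (simp add: sum_distrib_right)
  also have "\<dots> = (norm x)\<^sup>2"
    by (simp add: col norm_vec_def L2_set_def sum_nonneg)
  finally show ?thesis by (rule power2_le_imp_le) simp
qed

theorem corollary4p1:
  fixes A X :: "real ^ 'n ^ 'n"
  assumes "permutation_matrix A"
    and "proper_doubly_stochastic X"
    and "A ** X ** A = X ** A ** X"
  shows "\<exists>Y :: real ^ 'n ^ 'n. inner_inverse X Y \<and> doubly_stochastic Y"
proof -
  have ds: "doubly_stochastic X"
    using assms(2) by (simp add: proper_doubly_stochastic_def)
  have "X ** transpose X ** X = X"
    by (rule contraction_braid_orthogonal_imp_partial_isometry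
        [OF permutation_matrix_imp_orthogonal_matrix[OF assms(1)]
          doubly_stochastic_contraction[OF ds] assms(3)])
  then show ?thesis
    using doubly_stochastic_transpose[OF ds] by (auto simp: inner_inverse_def)
qed

end
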